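(* Let $w$ be a Bergman weight. If the inequality $$\frac{h_{2m}}{h_{2(m-1)}}\geq \frac{h_{2(m+1)}}{(m+1)\,h_{2(m-1)}}+\frac{m}{m+1}\cdot\frac{h_{2(m+1)}}{h_{2m}}$$ holds for all integers $m\geq 1$, then for every real $q\geq 1$ $$\sum_{n=0}^{\infty}\frac{q^n}{(n!)^2}h_{2n}\leq \left(\sum_{n=0}^{\infty}\frac{h_{2n}}{(n!)^2}\right)^q.$$
   Context: A Bergman weight is a summable (integrable) nonnegative function $w$ on $[0,1)$. Its moments are $h_m=\int_0^1\rho^{m+1}w(\rho)\,d\rho$ for integers $m\geq 0$, and the normalization $h_0=1$ is always assumed. *)

theory Defs
  imports "HOL-Analysis.Analysis"
begin

text \<open>Weights are total functions on the reals; only their values on \<open>[0,1)\<close> matter.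
  The normalization of the zeroth moment is not part of this predicate.\<close>

definition bergman_weight :: "(real \<Rightarrow> real) \<Rightarrow> bool" where
  "bergman_weight w \<longleftrightarrow>
     (\<forall>\<rho>\<in>{0..<1}. 0 \<le> w \<rho>) \<and> set_integrable lebesgue {0..<1} w"

definition bergman_moment :: "(real \<Rightarrow> real) \<Rightarrow> nat \<Rightarrow> real" where
  "bergman_moment w m = (LINT \<rho>:{0..<1}|lebesgue. \<rho> ^ (m + 1) * w \<rho>)"

end

theory Submission
  imports Defs
begin

text \<open>
  Put \<open>F(q) = (\<Sum>n. c\<^sub>n q\<^sup>n)\<close> with \<open>c\<^sub>n = h\<^sub>2\<^sub>n / (n!)\<^sup>2\<close>, so that the claim is
  \<open>F(q) \<le> F(1)\<^sup>q\<close>. Since \<open>F(0) = h\<^sub>0 = 1\<close>, the function \<open>ln F\<close> vanishes at \<open>0\<close>; if it is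
  concave on \<open>[0,\<infinity>)\<close>, then its value at \<open>1 = (1/q) q + (1 - 1/q) 0\<close> is at least
  \<open>ln F(q) / q\<close>, which is the claim.

  Concavity means that \<open>F' / F\<close> decreases. This is a quotient of two power series, and
  the quotient of their \<open>n\<close>-th coefficients is
  \<open>(n + 1) c\<^sub>n\<^sub>+\<^sub>1 / c\<^sub>n = h\<^sub>2\<^sub>n\<^sub>+\<^sub>2 / ((n + 1) h\<^sub>2\<^sub>n)\<close>. By the hypothesis on the moments,
  \<open>h\<^sub>2\<^sub>m / h\<^sub>2\<^sub>m\<^sub>-\<^sub>2\<close> is at least \<open>m / (m + 1)\<close> times \<open>h\<^sub>2\<^sub>m\<^sub>+\<^sub>2 / h\<^sub>2\<^sub>m\<close>, and division by \<open>m\<close>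
  shows that this sequence decreases. That the quotient of the
  series then decreases as well is the Biernacki--Krzyz principle
  (\<open>power_series_ratio_antimono\<close>), which is a symmetrization of a double sum, as in
  Chebyshev's sum inequality.

  The only measure theory needed is that the moments are positive, and that they are at most
  \<open>h\<^sub>0\<close>, which makes \<open>F\<close> entire.
\<close>

text \<open>
  Adding the double sum to its copy with \<open>m\<close> and \<open>n\<close> exchanged turns the difference of the two
  sides into a sum of the products
  \<open>(r\<^sub>m - r\<^sub>n) c\<^sub>m c\<^sub>n (x\<^sup>m y\<^sup>n - y\<^sup>m x\<^sup>n)\<close>, whose two differences always have the same sign.
\<close>

lemma partial_sum_ratio_antimono:
  fixes c r :: "nat \<Rightarrow> real"
  assumes c: "\<And>n. c n \<ge> 0" and r: "antimono r" and xy: "0 \<le> x" "x \<le> y"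
  shows "(\<Sum>n<N. r n * c n * y ^ n) * (\<Sum>n<N. c n * x ^ n)
       \<le> (\<Sum>n<N. r n * c n * x ^ n) * (\<Sum>n<N. c n * y ^ n)"
proof -
  define T where "T m n = r m * c m * c n * (x ^ m * y ^ n - y ^ m * x ^ n)" for m n
  have power_cross: "y ^ m * x ^ n \<le> x ^ m * y ^ n" if "m \<le> n" for m n
  proof -
    have "(x * y) ^ m * x ^ (n - m) \<le> (x * y) ^ m * y ^ (n - m)"
      using xy by (intro mult_left_mono power_mono) auto
    moreover have "x ^ n = x ^ m * x ^ (n - m)" "y ^ n = y ^ m * y ^ (n - m)"
      using that by (simp_all flip: power_add)
    ultimately show ?thesis by (simp add: power_mult_distrib mult_ac)
  qed
  have ordered: "0 \<le> T m n + T n m" if "m \<le> n" for m n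
  proof -
    have "T m n + T n m = (r m - r n) * (c m * c n) * (x ^ m * y ^ n - y ^ m * x ^ n)"
      by (simp add: T_def algebra_simps)
    also have "\<dots> \<ge> 0"
      using power_cross[OF that] antimonoD[OF r that] c by (intro mult_nonneg_nonneg) auto
    finally show ?thesis .
  qed
  have "0 \<le> (\<Sum>m<N. \<Sum>n<N. T m n + T n m)"
    using ordered by (intro sum_nonneg) (metis add.commute nat_le_linear)
  also have "\<dots> = (\<Sum>m<N. \<Sum>n<N. T m n) + (\<Sum>m<N. \<Sum>n<N. T n m)"
    by (simp add: sum.distrib)
  also have "(\<Sum>m<N. \<Sum>n<N. T n m) = (\<Sum>m<N. \<Sum>n<N. T m n)"
    by (rule sum.swap)
  finally have "0 \<le> (\<Sum>m<N. \<Sum>n<N. T m n)" by simp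
  also have "\<dots> = (\<Sum>n<N. r n * c n * x ^ n) * (\<Sum>n<N. c n * y ^ n)
                - (\<Sum>n<N. r n * c n * y ^ n) * (\<Sum>n<N. c n * x ^ n)"
    unfolding sum_product sum_subtractf[symmetric] T_def
    by (intro sum.cong refl) (simp add: algebra_simps)
  finally show ?thesis by simp
qed

lemma power_series_ratio_antimono:
  fixes c r :: "nat \<Rightarrow> real"
  assumes "\<And>n. c n \<ge> 0" "antimono r" "0 \<le> x" "x \<le> y"
    and "\<And>x. summable (\<lambda>n. c n * x ^ n)" "\<And>x. summable (\<lambda>n. r n * c n * x ^ n)"
  shows "(\<Sum>n. r n * c n * y ^ n) * (\<Sum>n. c n * x ^ n)
       \<le> (\<Sum>n. r n * c n * x ^ n) * (\<Sum>n. c n * y ^ n)"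
  by (rule LIMSEQ_le[OF tendsto_mult[OF summable_LIMSEQ summable_LIMSEQ]
        tendsto_mult[OF summable_LIMSEQ summable_LIMSEQ]])
     (use assms partial_sum_ratio_antimono in auto)

lemma power_series_pos:
  fixes c :: "nat \<Rightarrow> real"
  assumes c: "\<And>n. c n > 0" and sm: "\<And>x. summable (\<lambda>n. c n * x ^ n)" and "x \<ge> 0"
  shows "(\<Sum>n. c n * x ^ n) > 0"
proof (rule suminf_pos2[OF sm])
  show "0 \<le> c n * x ^ n" for n using less_imp_le[OF c] \<open>x \<ge> 0\<close> by simp
  show "0 < c 0 * x ^ 0" using c by simp
qed

text \<open>
  In terms of the Taylor coefficients \<open>n! c\<^sub>n\<close> at \<open>0\<close>, the monotonicity assumption is
  log-concavity of that sequence; the function inherits it on \<open>[0,\<infinity>)\<close>.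
\<close>

lemma ln_power_series_concave:
  fixes c :: "nat \<Rightarrow> real"
  assumes c: "\<And>n. c n > 0" and sm: "\<And>x. summable (\<lambda>n. c n * x ^ n)"
    and ratio: "antimono (\<lambda>n. real (Suc n) * c (Suc n) / c n)"
  shows "concave_on {0..} (\<lambda>x. ln (\<Sum>n. c n * x ^ n))"
proof -
  define F where "F x = (\<Sum>n. c n * x ^ n)" for x
  define D where "D x = (\<Sum>n. diffs c n * x ^ n)" for x
  have pos: "F x > 0" if "x \<ge> 0" for x
    unfolding F_def using c sm that by (rule power_series_pos)
  have F': "(F has_real_derivative D x) (at x)" for x
    unfolding F_def D_def by (rule termdiffs_strong_converges_everywhere) (rule sm)
  have diffs_eq: "real (Suc n) * c (Suc n) / c n * c n = diffs c n" for n
    using c[of n] by (simp add: diffs_def)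
  have cross: "D y * F x \<le> D x * F y" if "0 \<le> x" "x \<le> y" for x y
    using power_series_ratio_antimono[OF less_imp_le[OF c] ratio that sm]
    unfolding F_def D_def diffs_eq using termdiff_converges_all[OF sm] by blast
  have "convex_on {0..} (\<lambda>x. - ln (F x))"
  proof (rule convex_on_realI)
    fix x :: real assume "x \<in> {0..}"
    then show "((\<lambda>x. - ln (F x)) has_real_derivative - (D x / F x)) (at x)"
      using pos[of x] by (auto intro!: derivative_eq_intros F')
  next
    fix x y :: real assume "x \<in> {0..}" "y \<in> {0..}" "x \<le> y"
    then show "- (D x / F x) \<le> - (D y / F y)"
      using cross[of x y] pos[of x] pos[of y] by (simp add: field_simps)
  qed auto
  then show ?thesis by (simp add: concave_on_def F_def)
qed

lemma power_series_le_powr: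
  fixes c :: "nat \<Rightarrow> real"
  assumes c: "\<And>n. c n > 0" and c0: "c 0 = 1" and sm: "\<And>x. summable (\<lambda>n. c n * x ^ n)"
    and ratio: "antimono (\<lambda>n. real (Suc n) * c (Suc n) / c n)" and q: "q \<ge> 1"
  shows "(\<Sum>n. c n * q ^ n) \<le> (\<Sum>n. c n) powr q"
proof -
  define F where "F x = (\<Sum>n. c n * x ^ n)" for x
  have pos: "F x > 0" if "x \<ge> 0" for x
    unfolding F_def using c sm that by (rule power_series_pos)
  have F0: "F 0 = 1" using c0 by (simp add: F_def powser_zero)
  have F1: "F 1 = (\<Sum>n. c n)" by (simp add: F_def)
  have "concave_on {0..} (\<lambda>x. ln (F x))"
    unfolding F_def by (rule ln_power_series_concave[OF c sm ratio])
  from concave_onD[OF this, of "1 / q" 0 q] q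
  have "ln (F q) \<le> q * ln (F 1)" by (simp add: F0 field_simps)
  then have "exp (ln (F q)) \<le> exp (q * ln (F 1))" by simp
  then have "F q \<le> F 1 powr q"
    using pos[of q] pos[of 1] q by (simp add: powr_def)
  then show ?thesis unfolding F1 by (simp add: F_def)
qed

lemma bergman_moment_integrable:
  assumes "bergman_weight w"
  shows "set_integrable lebesgue {0..<1} (\<lambda>\<rho>. \<rho> ^ k * w \<rho>)"
proof -
  have w: "integrable lebesgue (\<lambda>\<rho>. indicat_real {0..<1} \<rho> * w \<rho>)"
    using assms by (simp add: bergman_weight_def set_integrable_def)
  have id: "(\<lambda>\<rho>::real. \<rho>) \<in> borel_measurable lebesgue"
    by (rule measurable_completion) simp
  have "integrable lebesgue (\<lambda>\<rho>. \<rho> ^ k * (indicat_real {0..<1} \<rho> * w \<rho>))"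
  proof (rule Bochner_Integration.integrable_bound[OF w])
    show "(\<lambda>\<rho>. \<rho> ^ k * (indicat_real {0..<1} \<rho> * w \<rho>)) \<in> borel_measurable lebesgue"
      using id borel_measurable_integrable[OF w]
      by (rule borel_measurable_times[OF borel_measurable_power])
    show "AE \<rho> in lebesgue. norm (\<rho> ^ k * (indicat_real {0..<1} \<rho> * w \<rho>))
            \<le> norm (indicat_real {0..<1} \<rho> * w \<rho>)"
      by (rule AE_I2)
         (auto simp: indicator_def abs_mult power_le_one intro: mult_left_le_one_le)
  qed
  then show ?thesis
    by (simp add: set_integrable_def mult_ac)
qed

lemma bergman_moment_antimono:
  assumes w: "bergman_weight w" and "j \<le> k"
  shows "bergman_moment w k \<le> bergman_moment w j"
  unfolding bergman_moment_def
proof (rule set_integral_mono[OF bergman_moment_integrable[OF w] bergman_moment_integrable[OF w]])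
  fix \<rho> :: real assume "\<rho> \<in> {0..<1}"
  then show "\<rho> ^ (k + 1) * w \<rho> \<le> \<rho> ^ (j + 1) * w \<rho>"
    using w \<open>j \<le> k\<close> by (intro mult_right_mono power_decreasing) (auto simp: bergman_weight_def)
qed

text \<open>
  A vanishing moment forces \<open>w = 0\<close> almost everywhere on \<open>(0,1)\<close>, hence all moments vanish.
\<close>

lemma bergman_moment_pos:
  assumes w: "bergman_weight w" and nz: "bergman_moment w 0 \<noteq> 0"
  shows "bergman_moment w k > 0"
proof -
  define f where "f j = (\<lambda>\<rho>. indicat_real {0..<1} \<rho> * (\<rho> ^ (j + 1) * w \<rho>))" for j
  have int: "integrable lebesgue (f j)" for j
    using bergman_moment_integrable[OF w, of "j + 1"] by (simp add: set_integrable_def f_def)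
  have nonneg: "0 \<le> f j \<rho>" for j \<rho>
    using w by (auto simp: f_def bergman_weight_def indicator_def)
  have moment: "bergman_moment w j = integral\<^sup>L lebesgue (f j)" for j
    by (simp add: bergman_moment_def set_lebesgue_integral_def f_def)
  have zero: "bergman_moment w j = 0 \<longleftrightarrow> (AE \<rho> in lebesgue. f j \<rho> = 0)" for j
    unfolding moment by (rule integral_nonneg_eq_0_iff_AE[OF int]) (simp add: nonneg)
  have "bergman_moment w k \<noteq> 0"
  proof
    assume "bergman_moment w k = 0"
    then have "AE \<rho> in lebesgue. f k \<rho> = 0" using zero by blast
    then have "AE \<rho> in lebesgue. f 0 \<rho> = 0"
      by eventually_elim (auto simp: f_def)
    then show False using zero nz by blast
  qed
  moreover have "bergman_moment w k \<ge> 0"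
    unfolding moment by (rule integral_nonneg_AE) (simp add: nonneg)
  ultimately show ?thesis by simp
qed

theorem theorem1p2:
  fixes w :: "real \<Rightarrow> real" and h :: "nat \<Rightarrow> real" and q :: real
  defines "h \<equiv> bergman_moment w"
  assumes "bergman_weight w"
    and "h 0 = 1"
    and "\<And>m::nat. m \<ge> 1 \<Longrightarrow>
      h (2 * m) / h (2 * (m - 1)) \<ge>
        h (2 * (m + 1)) / (real (m + 1) * h (2 * (m - 1)))
        + real m / real (m + 1) * (h (2 * (m + 1)) / h (2 * m))"
    and "q \<ge> 1"
  shows "(\<Sum>n. q ^ n / (fact n)\<^sup>2 * h (2 * n)) \<le> (\<Sum>n. h (2 * n) / (fact n)\<^sup>2) powr q"
proof -
  have pos: "h k > 0" for k
    using bergman_moment_pos[of w k] assms(2,3) by (simp add: h_def)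
  have le1: "h k \<le> 1" for k
    using bergman_moment_antimono[of w 0 k] assms(2,3) by (simp add: h_def)
  define c where "c n = h (2 * n) / (fact n)\<^sup>2" for n
  have c: "c n > 0" for n using pos by (simp add: c_def)
  have c0: "c 0 = 1" using assms(3) by (simp add: c_def)
  have sm: "summable (\<lambda>n. c n * x ^ n)" for x
  proof (rule summable_comparison_test')
    show "summable (\<lambda>n. inverse (fact n) * \<bar>x\<bar> ^ n)" by (rule summable_exp)
    fix n :: nat
    have "h (2 * n) * fact n \<le> 1 * (fact n * fact n)"
      using pos[of "2 * n"] le1[of "2 * n"] fact_ge_1[of n, where 'a=real]
      by (intro mult_mono) auto
    then have "c n \<le> inverse (fact n)"
      by (simp add: c_def power2_eq_square divide_simps)
    then show "norm (c n * x ^ n) \<le> inverse (fact n) * \<bar>x\<bar> ^ n"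
      using c[of n] by (simp add: abs_mult power_abs mult_right_mono)
  qed
  have ratio_eq: "real (Suc n) * c (Suc n) / c n = h (2 * Suc n) / (real (Suc n) * h (2 * n))" for n
    using pos[of "2 * n"] by (simp add: c_def power2_eq_square divide_simps)
  have ratio: "antimono (\<lambda>n. real (Suc n) * c (Suc n) / c n)"
    unfolding ratio_eq
  proof (rule decseq_SucI)
    fix n
    let ?a = "h (2 * n)" and ?b = "h (2 * Suc n)" and ?d = "h (2 * Suc (Suc n))"
    have "0 < ?d / (real (Suc (Suc n)) * ?a)" using pos by simp
    then have "real (Suc n) / real (Suc (Suc n)) * (?d / ?b) \<le> ?b / ?a"
      using assms(4)[of "Suc n"] by simp
    then have "real (Suc n) / real (Suc (Suc n)) * (?d / ?b) / real (Suc n) \<le> ?b / ?a / real (Suc n)"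
      by (rule divide_right_mono) simp
    then show "?d / (real (Suc (Suc n)) * ?b) \<le> ?b / (real (Suc n) * ?a)"
      by (simp add: mult_ac)
  qed
  have "(\<Sum>n. c n * q ^ n) \<le> (\<Sum>n. c n) powr q"
    by (rule power_series_le_powr[OF c c0 sm ratio \<open>q \<ge> 1\<close>])
  then show ?thesis by (simp add: c_def mult_ac)
qed

end
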